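(* Let $\alpha,\mu\ge0$, $\beta>0$ with $\alpha-\beta(\mu+1)<0$. For $r>0$ put $$S^!_{\alpha,\beta,\mu}(r):=\sum_{n=0}^\infty\frac{(n!)^\alpha}{\big((n!)^\beta+r^2\big)^{\mu+1}}.$$ Then $$S^!_{\alpha,\beta,\mu}(r)=O\Big(r^{-2(\mu+1-\alpha/\beta)}\,\frac{\log r}{\log\log r}\Big),\qquad r\to\infty.$$ *)

theory Defs
  imports "HOL-Analysis.Analysis" "HOL-Library.Landau_Symbols"
begin

definition fact_mathieu :: "real \<Rightarrow> real \<Rightarrow> real \<Rightarrow> real \<Rightarrow> real" where
  "fact_mathieu \<alpha> \<beta> \<mu> r =
     (\<Sum>n. (fact n :: real) powr \<alpha> / ((fact n :: real) powr \<beta> + r\<^sup>2) powr (\<mu> + 1))"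

(* suminf takes an unspecified value on divergent series; under the standing
   assumptions on the parameters the defining series does converge. *)
lemma summable_fact_mathieu:
  fixes \<alpha> \<beta> \<mu> r :: real
  assumes "\<mu> \<ge> 0" and "\<alpha> - \<beta> * (\<mu> + 1) < 0"
  shows "summable (\<lambda>n. (fact n :: real) powr \<alpha> / ((fact n :: real) powr \<beta> + r\<^sup>2) powr (\<mu> + 1))"
proof -
  define c where "c = \<beta> * (\<mu> + 1) - \<alpha>"
  have c: "c > 0" using assms by (simp add: c_def)
  define q :: real where "q = 2 powr (- c)"
  have q: "0 < q" "q < 1" using c by (auto simp: q_def powr_minus_divide)
  have two_fact: "2 ^ n \<le> 2 * (fact n :: real)" for n :: nat
  proof (induction n)
    case (Suc n)
    show ?case
    proof (cases "n = 0")
      case False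
      have "2 ^ Suc n \<le> 2 * (2 * (fact n :: real))" using Suc by simp
      also have "\<dots> \<le> 2 * (fact (Suc n) :: real)" using False by simp
      finally show ?thesis .
    qed simp
  qed simp
  show ?thesis
  proof (rule summable_comparison_test')
    show "summable (\<lambda>n. 2 powr c * q ^ n)"
      using q by (intro summable_mult summable_geometric) auto
  next
    fix n :: nat
    let ?f = "fact n :: real"
    have f: "?f > 0" by simp
    have "?f powr (\<beta> * (\<mu> + 1)) = (?f powr \<beta>) powr (\<mu> + 1)"
      by (simp add: powr_powr)
    also have "\<dots> \<le> (?f powr \<beta> + r\<^sup>2) powr (\<mu> + 1)"
      using assms by (intro powr_mono2) auto
    finally have "?f powr \<alpha> / (?f powr \<beta> + r\<^sup>2) powr (\<mu> + 1)
        \<le> ?f powr \<alpha> / ?f powr (\<beta> * (\<mu> + 1))"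
      by (intro divide_left_mono mult_pos_pos) (auto simp: add_pos_nonneg)
    also have "\<dots> = ?f powr (- c)" by (simp add: c_def powr_diff)
    also have "\<dots> \<le> (2 ^ n / 2) powr (- c)"
      using two_fact[of n] c by (intro powr_mono2') auto
    also have "\<dots> = 2 powr c * q ^ n"
    proof -
      have "(2 ^ n / 2 :: real) = 2 powr (real n - 1)"
        by (simp add: powr_diff powr_realpow)
      moreover have "q ^ n = 2 powr (- c * real n)"
        by (simp add: q_def powr_powr flip: powr_realpow)
      ultimately show ?thesis
        by (simp add: powr_powr algebra_simps flip: powr_add)
    qed
    finally show "norm (?f powr \<alpha> / (?f powr \<beta> + r\<^sup>2) powr (\<mu> + 1)) \<le> 2 powr c * q ^ n"
      by simp
  qed
qed

end

(* With x = r powr (2 / \<beta>), each term with n! \<le> x is at most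
   R = r powr (- 2 * (\<mu> + 1 - \<alpha> / \<beta>)), and the terms with n! > x decay at least
   geometrically from R on, so they contribute only O(R).  By Stirling's lower bound
   there are O(ln x / ln (ln x)) indices of the first kind. *)
theory Submission
  imports Defs "HOL-Real_Asymp.Real_Asymp"
begin

text \<open>Going from \<open>n\<close> to \<open>Suc n\<close> amounts to
  \<open>n * (ln (n + 1) - ln n) \<le> 1\<close>, which is \<open>ln (1 + u) \<le> u\<close> at
  \<open>u = 1 / n\<close>.\<close>

lemma ln_fact_ge: "real n * ln (real n) - real n \<le> ln (fact n)"
proof (induction n)
  case (Suc n)
  show ?case
  proof (cases "n = 0")
    case False
    have "ln (real (Suc n)) - ln (real n) = ln (1 + 1 / real n)"
    proof -
      have "1 + 1 / real n = real (Suc n) / real n"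
        using False by (simp add: field_simps)
      then show ?thesis using False by (simp add: ln_div del: of_nat_Suc)
    qed
    also have "\<dots> \<le> 1 / real n"
      by (rule ln_add_one_self_le_self) simp
    finally have "real n * (ln (real (Suc n)) - ln (real n)) \<le> 1"
      using False by (simp add: field_simps)
    moreover have "ln (fact (Suc n) :: real) = ln (real (Suc n)) + ln (fact n)"
      by (simp add: ln_mult del: of_nat_Suc)
    ultimately show ?thesis
      using Suc by (simp add: algebra_simps)
  qed simp
qed simp

text \<open>Put \<open>L = ln x\<close> and split at \<open>n = sqrt L\<close>. Below it,
  \<open>ln L \<le> 2 * sqrt L\<close> makes \<open>n * ln L\<close> at most \<open>2 * L\<close>.
  Above it, \<open>ln n\<close> is at least half of \<open>ln L\<close>, so the lower bound for
  \<open>ln (fact n)\<close>, which is at most \<open>L\<close>, controls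
  \<open>n * ln L\<close>.\<close>

lemma fact_le_imp_le_ln_div_ln_ln:
  fixes x :: real
  assumes x: "x > 0" and lnln: "ln (ln x) \<ge> 4" and fact: "fact n \<le> x"
  shows "real n \<le> 4 * ln x / ln (ln x)"
proof -
  define L where "L = ln x"
  have lL: "ln L \<ge> 4" using lnln by (simp add: L_def)
  \<comment> \<open>As \<open>ln\<close> is total, \<open>ln L \<ge> 4\<close> alone does not give
    \<open>L > 0\<close>. The sign comes from \<open>1 \<le> fact n \<le> x\<close>, and the
    convention \<open>ln 0 = 0\<close> then excludes \<open>L = 0\<close>.\<close>
  have L: "L \<ge> 0"
  proof -
    have "(1::real) \<le> fact n" by simp
    with fact have "1 \<le> x" by linarith
    then show ?thesis by (simp add: L_def)
  qed
  have L0: "L > 0" using L lL by (cases "L = 0") auto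
  have "real n * ln L \<le> 4 * L"
  proof (cases "real n \<le> sqrt L")
    case True
    have "ln (sqrt L) \<le> sqrt L" using L0 by (intro less_imp_le ln_less_self) simp
    then have "ln L \<le> 2 * sqrt L" using L0 by (simp add: ln_sqrt)
    then have "real n * ln L \<le> sqrt L * (2 * sqrt L)"
      using True lL L by (intro mult_mono) auto
    also have "\<dots> = 2 * L" using L by simp
    finally show ?thesis using L by simp
  next
    case False
    have "ln (sqrt L) \<le> ln (real n)"
      using False L0 by (intro ln_mono) (auto simp: not_le)
    \<comment> \<open>The threshold 4 is exactly what gives
      \<open>ln L / 2 - 1 \<ge> ln L / 4\<close>.\<close>
    then have "ln L / 4 \<le> ln (real n) - 1"
      using L0 lL by (simp add: ln_sqrt)
    then have "real n * (ln L / 4) \<le> real n * (ln (real n) - 1)"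
      by (intro mult_left_mono) auto
    also have "\<dots> \<le> ln (fact n)" using ln_fact_ge [of n] by (simp add: algebra_simps)
    also have "\<dots> \<le> L" unfolding L_def using fact x by (intro ln_mono) auto
    finally show ?thesis by simp
  qed
  then show ?thesis using lL by (simp add: L_def field_simps)
qed

text \<open>Each of the \<open>k\<close> factors after \<open>m\<close> is at least 2. This fails
  for \<open>m = 0\<close>, since \<open>fact 0 = fact 1\<close>.\<close>

lemma fact_add_ge: "m \<ge> 1 \<Longrightarrow> 2 ^ k * (fact m :: real) \<le> fact (k + m)"
proof (induction k)
  case (Suc k)
  have "2 * (2 ^ k * (fact m :: real)) \<le> real (Suc (k + m)) * fact (k + m)"
    using Suc by (intro mult_mono) auto
  then show ?case by simp
qed simp

text \<open>The cut-off \<open>r powr (2 / \<beta>)\<close> is where the two summands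
  \<open>fact n powr \<beta>\<close> and \<open>r\<^sup>2\<close> of the denominator balance. On
  each side only the dominant one is kept: the \<open>m\<close> head terms are bounded one by one,
  the tail by a geometric series.\<close>

lemma fact_mathieu_le:
  fixes \<alpha> \<beta> \<mu> r :: real
  assumes \<alpha>: "\<alpha> \<ge> 0" and \<mu>: "\<mu> \<ge> 0" and \<beta>: "\<beta> > 0"
    and neg: "\<alpha> - \<beta> * (\<mu> + 1) < 0" and r: "r > 0"
    and below: "\<And>n. n < m \<Longrightarrow> fact n \<le> r powr (2 / \<beta>)"
    and above: "r powr (2 / \<beta>) < fact m" and m: "m \<ge> 1"
  shows "fact_mathieu \<alpha> \<beta> \<mu> r
    \<le> r powr (- 2 * (\<mu> + 1 - \<alpha> / \<beta>)) * (real m + 1 / (1 - 2 powr (\<alpha> - \<beta> * (\<mu> + 1))))"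
proof -
  define x where "x = r powr (2 / \<beta>)"
  define R where "R = r powr (- 2 * (\<mu> + 1 - \<alpha> / \<beta>))"
  define c where "c = \<beta> * (\<mu> + 1) - \<alpha>"
  define q :: real where "q = 2 powr (- c)"
  define f where "f = (\<lambda>n. (fact n :: real) powr \<alpha> / ((fact n :: real) powr \<beta> + r\<^sup>2) powr (\<mu> + 1))"
  have c: "c > 0" using neg by (simp add: c_def)
  have q: "0 < q" "q < 1" using c by (auto simp: q_def powr_minus_divide)
  have x: "x > 0" using r by (simp add: x_def)
  have R: "x powr (- c) = R"
    using \<beta> by (simp add: x_def R_def powr_powr c_def field_simps)
  have summ: "summable f"
    unfolding f_def using summable_fact_mathieu \<mu> neg by blast
  have head: "f n \<le> R" if "n < m" for n
  proof -
    \<comment> \<open>In the head \<open>r\<^sup>2\<close> dominates; the numerator is then largest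
      at \<open>fact n = x\<close>.\<close>
    have "r\<^sup>2 powr (\<mu> + 1) \<le> ((fact n :: real) powr \<beta> + r\<^sup>2) powr (\<mu> + 1)"
      using \<mu> r by (intro powr_mono2) auto
    then have "f n \<le> x powr \<alpha> / r\<^sup>2 powr (\<mu> + 1)"
      unfolding f_def using below [OF that] \<alpha> \<mu> r
      by (intro frac_le powr_mono2) (auto simp: x_def)
    also have "\<dots> = R"
      using r by (simp add: x_def R_def powr_powr powr_numeral [symmetric]
          powr_diff [symmetric] algebra_simps del: powr_numeral)
    finally show ?thesis .
  qed
  have tail: "f (k + m) \<le> R * q ^ k" for k
  proof -
    let ?F = "fact (k + m) :: real"
    have F: "?F > 0" by simp
    \<comment> \<open>In the tail the factorial dominates; dropping \<open>r\<^sup>2\<close> leaves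
      the pure power \<open>?F powr (- c)\<close>, which decreases in \<open>?F\<close>.\<close>
    have "?F powr (\<beta> * (\<mu> + 1)) = (?F powr \<beta>) powr (\<mu> + 1)"
      by (simp add: powr_powr)
    also have "\<dots> \<le> (?F powr \<beta> + r\<^sup>2) powr (\<mu> + 1)"
      using \<mu> by (intro powr_mono2) auto
    finally have "f (k + m) \<le> ?F powr \<alpha> / ?F powr (\<beta> * (\<mu> + 1))"
      unfolding f_def by (intro divide_left_mono mult_pos_pos) (auto simp: add_pos_nonneg)
    also have "\<dots> = ?F powr (- c)" by (simp add: c_def powr_diff)
    also have "\<dots> \<le> (2 ^ k * x) powr (- c)"
    proof (intro powr_mono2')
      have "2 ^ k * x \<le> 2 ^ k * (fact m :: real)"
        using above by (simp add: x_def)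
      then show "2 ^ k * x \<le> ?F" using fact_add_ge [OF m, of k] by linarith
    qed (use c x in auto)
    also have "\<dots> = R * q ^ k"
    proof -
      have "(2 ^ k :: real) powr (- c) = q ^ k"
        by (simp add: q_def powr_powr mult.commute flip: powr_realpow)
      then show ?thesis using x by (simp add: powr_mult R)
    qed
    finally show ?thesis .
  qed
  have "suminf f = (\<Sum>k. f (k + m)) + (\<Sum>n<m. f n)"
    using summ by (rule suminf_split_initial_segment)
  also have "(\<Sum>n<m. f n) \<le> real m * R"
    using sum_bounded_above [of "{..<m}" f R] head by simp
  also have "(\<Sum>k. f (k + m)) \<le> (\<Sum>k. R * q ^ k)"
    using q by (intro suminf_le tail summable_mult summable_geometric summable_ignore_initial_segment summ) auto
  also have "(\<Sum>k. R * q ^ k) = R * (1 / (1 - q))"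
    using q by (simp add: suminf_mult suminf_geometric summable_geometric)
  finally show ?thesis
    by (simp add: fact_mathieu_def f_def R_def q_def c_def algebra_simps)
qed

theorem theorem1p5:
  fixes \<alpha> \<beta> \<mu> :: real
  assumes "\<alpha> \<ge> 0" and "\<mu> \<ge> 0" and "\<beta> > 0"
    and "\<alpha> - \<beta> * (\<mu> + 1) < 0"
  shows "(\<lambda>r. fact_mathieu \<alpha> \<beta> \<mu> r) \<in>
    O[at_top](\<lambda>r. r powr (- 2 * (\<mu> + 1 - \<alpha> / \<beta>)) * (ln r / ln (ln r)))"
proof -
  \<comment> \<open>\<open>K - 1\<close> is the sum of the geometric tail; the extra 1 pays for
    passing from \<open>m - 1\<close> to \<open>m\<close> below.\<close>
  define K where "K = 1 + 1 / (1 - 2 powr (\<alpha> - \<beta> * (\<mu> + 1)))"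
  have "(2::real) powr (\<alpha> - \<beta> * (\<mu> + 1)) < 2 powr 0"
    using assms(4) by (intro powr_less_mono) auto
  then have K: "K \<ge> 0" by (simp add: K_def)
  show ?thesis
  proof (rule bigoI [where c = "16 / \<beta> + K"])
    have "eventually (\<lambda>r. r > (1::real)) at_top"
      by real_asymp
    moreover have "eventually (\<lambda>r::real. ln (2 / \<beta> * ln r) \<ge> 4) at_top"
      using assms(3) by real_asymp
    \<comment> \<open>With \<open>x = r powr (2 / \<beta>)\<close> the left side is
      \<open>ln (ln x)\<close>, which differs from \<open>ln (ln r)\<close> by the constant
      \<open>ln (2 / \<beta>)\<close>. Halving absorbs it even when it is negative, and turns
      \<open>8 / \<beta>\<close> into \<open>16 / \<beta>\<close>.\<close>
    moreover have "eventually (\<lambda>r::real. ln (2 / \<beta> * ln r) \<ge> ln (ln r) / 2) at_top"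
      using assms(3) by real_asymp
    moreover have "eventually (\<lambda>r::real. ln (ln r) > 0) at_top"
      by real_asymp
    ultimately show "eventually (\<lambda>r. norm (fact_mathieu \<alpha> \<beta> \<mu> r) \<le> (16 / \<beta> + K) *
      norm (r powr (- 2 * (\<mu> + 1 - \<alpha> / \<beta>)) * (ln r / ln (ln r)))) at_top"
    proof eventually_elim
      case (elim r)
      define x where "x = r powr (2 / \<beta>)"
      define R where "R = r powr (- 2 * (\<mu> + 1 - \<alpha> / \<beta>))"
      define m where "m = (LEAST m. x < fact m)"
      have x: "x > 1" using elim assms(3) by (simp add: x_def)
      have lnx: "ln x = 2 / \<beta> * ln r" using elim by (simp add: x_def ln_powr)
      obtain n where "x < real n" using reals_Archimedean2 by blast
      also have "real n \<le> fact n" by (metis fact_ge_self of_nat_fact of_nat_le_iff)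
      finally have above: "x < fact m" unfolding m_def by (rule LeastI)
      have below: "fact n \<le> x" if "n < m" for n
        using not_less_Least [of n "\<lambda>m. x < fact m"] that by (simp add: m_def)
      \<comment> \<open>Index 0 is excluded because \<open>fact 0 = 1 < x\<close>.\<close>
      have m: "m \<ge> 1" using above x by (cases m) auto
      \<comment> \<open>By minimality of \<open>m\<close>, \<open>m - 1\<close> is the last index
        whose factorial is at most \<open>x\<close>.\<close>
      have "real (m - 1) \<le> 4 * ln x / ln (ln x)"
        using x elim m by (intro fact_le_imp_le_ln_div_ln_ln below) (auto simp: lnx)
      also have "\<dots> = 8 / \<beta> * ln r / ln (2 / \<beta> * ln r)" by (simp add: lnx)
      also have "\<dots> \<le> 8 / \<beta> * ln r / (ln (ln r) / 2)"
      proof (intro divide_left_mono mult_pos_pos)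
        show "ln (2 / \<beta> * ln r) > 0" using elim by linarith
      qed (use elim assms(3) in auto)
      finally have m_le: "real m \<le> 16 / \<beta> * (ln r / ln (ln r)) + 1"
        using m by (simp add: of_nat_diff)
      \<comment> \<open>This lets the additive constant \<open>K\<close> be absorbed into a multiple
        of \<open>ln r / ln (ln r)\<close>.\<close>
      have "ln r / ln (ln r) \<ge> 1"
      proof -
        have "ln r > 0" using elim by simp
        then have "ln (ln r) \<le> ln r" by (intro less_imp_le ln_less_self)
        then show ?thesis using elim by (simp add: le_divide_eq)
      qed
      then have "K \<le> K * (ln r / ln (ln r))"
        using K mult_left_mono [of 1 "ln r / ln (ln r)" K] by simp
      then have le: "real m + (K - 1) \<le> (16 / \<beta> + K) * (ln r / ln (ln r))"
        using m_le by (simp only: distrib_right)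
      have "fact_mathieu \<alpha> \<beta> \<mu> r \<le> R * (real m + (K - 1))"
        unfolding R_def K_def using fact_mathieu_le [OF assms _ below [unfolded x_def] above [unfolded x_def] m] elim
        by simp
      also have "\<dots> \<le> R * ((16 / \<beta> + K) * (ln r / ln (ln r)))"
        using le by (intro mult_left_mono) (auto simp: R_def)
      finally have *: "fact_mathieu \<alpha> \<beta> \<mu> r \<le> (16 / \<beta> + K) * (R * (ln r / ln (ln r)))"
        by (simp only: mult_ac)
      have "fact_mathieu \<alpha> \<beta> \<mu> r \<ge> 0"
        unfolding fact_mathieu_def
        by (intro suminf_nonneg summable_fact_mathieu assms) auto
      moreover have "R * (ln r / ln (ln r)) \<ge> 0"
        using elim by (simp add: R_def)
      ultimately show ?case
        using * unfolding R_def by (simp only: real_norm_def abs_of_nonneg)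
    qed
  qed
qed

end
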